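(* Let $b>a>0$. Then for every real $p\ge1$, $$\left|\frac{1}{H(a,b)}-\frac{1}{L(a,b)}\right|\le\frac{(b-a)^{2}}{2^{1-1/p}[(p+2)(p+3)]^{1/p}}\left[\frac{1}{a^{3p}}+\frac{2}{(p+1)b^{3p}}\right]^{1/p}.$$
   Context: For positive reals $\alpha\ne\beta$, $H(\alpha,\beta)=\frac{2}{1/\alpha+1/\beta}$ is the harmonic mean and $L(\alpha,\beta)=\frac{\alpha-\beta}{\ln\alpha-\ln\beta}$ is the logarithmic mean. *)

theory Defs
  imports Complex_Main
begin

(* Both means are meant for positive, distinct arguments only; the values that the
   totality of division and of ln gives elsewhere carry no meaning. *)

definition harmonic_mean :: "real \<Rightarrow> real \<Rightarrow> real" where
  "harmonic_mean \<alpha> \<beta> = 2 / (1 / \<alpha> + 1 / \<beta>)"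

definition logarithmic_mean :: "real \<Rightarrow> real \<Rightarrow> real" where
  "logarithmic_mean \<alpha> \<beta> = (\<alpha> - \<beta>) / (ln \<alpha> - ln \<beta>)"

end

theory Submission
  imports Defs "HOL-Analysis.Convex"
begin

text \<open>
  The difference of the reciprocal means is the error of the trapezoidal rule for \<open>1 / x\<close> on
  \<open>[a, b]\<close>: on the one hand \<open>1 / H\<close> is the mean of the endpoint values \<open>1 / a\<close> and \<open>1 / b\<close>, on the
  other \<open>1 / L\<close> is the average of \<open>1 / x\<close> over the interval. Writing \<open>x(t) = t a + (1 - t) b\<close> and
  integrating by parts twice gives
  \[ 1 / H - 1 / L = (b - a)^2 \int_0^1 t (1 - t) x(t)^{-3} \, dt. \]
  The integrand is nonnegative, so the absolute value may be dropped. By Hoelder's inequality for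
  the weight \<open>1 - t\<close>, whose total mass is \<open>1 / 2\<close>, the integral is at most
  \[ (1 / 2)^{1 - 1/p} \Big( \int_0^1 (1 - t) t^p x(t)^{-3p} \, dt \Big)^{1/p}, \]
  and the convexity of \<open>x powr (- 3 * p)\<close> bounds \<open>x(t)^{-3p}\<close> by
  \<open>t a^{-3p} + (1 - t) b^{-3p}\<close>. The two Beta integrals that remain are
  \<open>1 / ((p + 2) (p + 3))\<close> and \<open>2 / ((p + 1) (p + 2) (p + 3))\<close>.

  Hoelder's inequality enters through its pointwise form, Young's inequality with a free scale
  \<open>c\<close> (\<open>le_scaled_powr\<close>); this gives a bound for every \<open>c > 0\<close>
  (\<open>trapezoid_error_le_scaled\<close>), and the best \<open>c\<close> recovers the \<open>1 / p\<close>-th root. Every integrand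
  that occurs has an elementary antiderivative, so integrals are compared by the monotonicity of
  a function with nonnegative derivative.
\<close>

section \<open>Convexity and Young's inequality\<close>

lemma powr_minus_convex:
  fixes q :: real
  assumes "0 \<le> q"
  shows "convex_on {0<..} (\<lambda>x. x powr (- q))"
proof (rule f''_ge0_imp_convex)
  show "((\<lambda>x. x powr (- q)) has_real_derivative (- q) * x powr (- q - 1)) (at x)"
    if "x \<in> {0<..}" for x :: real
    using that by (intro has_real_derivative_powr) auto
  show "((\<lambda>x. (- q) * x powr (- q - 1)) has_real_derivative
      (- q) * ((- q - 1) * x powr (- q - 1 - 1))) (at x)"
    if "x \<in> {0<..}" for x :: real
    using that by (intro DERIV_cmult has_real_derivative_powr) auto
  show "0 \<le> (- q) * ((- q - 1) * x powr (- q - 1 - 1))" for x :: real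
    using assms by (intro mult_nonpos_nonpos mult_nonpos_nonneg) auto
qed auto

text \<open>
  Since \<open>u\<close> is the weighted geometric mean of \<open>c powr (1 - p) * u powr p\<close> and \<open>c\<close>, this is the
  weighted inequality of the means. Equality holds at \<open>c = u\<close>, so nothing is lost once \<open>c\<close> is
  chosen well.
\<close>

lemma le_scaled_powr:
  fixes u c p :: real
  assumes "0 < u" "0 < c" "1 \<le> p"
  shows "u \<le> c powr (1 - p) * u powr p / p + (1 - 1 / p) * c"
proof -
  have "(c powr (1 - p) * u powr p) powr (1 / p) * c powr (1 - 1 / p)
      = u * (c powr ((1 - p) / p) * c powr (1 - 1 / p))"
    using assms by (simp add: powr_mult powr_powr)
  also have "\<dots> = u"
    using assms by (simp add: powr_add [symmetric] diff_divide_distrib)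
  finally show ?thesis
    using Youngs_inequality_0 [of "1 / p" "1 - 1 / p" "c powr (1 - p) * u powr p" c] assms
    by simp
qed

section \<open>The trapezoidal error of the reciprocal\<close>

text \<open>
  Two integrations by parts applied to \<open>(b - a)\<^sup>2 * t * (1 - t) / x(t) ^ 3\<close>, which is half of
  \<open>t * (1 - t)\<close> times the second derivative of \<open>1 / x(t)\<close>, leave this antiderivative.
  Here \<open>x(t) = b - t * (b - a)\<close>.
\<close>

definition trapezoid_primitive :: "real \<Rightarrow> real \<Rightarrow> real \<Rightarrow> real" where
  "trapezoid_primitive a b t =
     (t * (1 - t) * (b - a) / (b - t * (b - a))\<^sup>2 - (1 - 2 * t) / (b - t * (b - a))
      + 2 * ln (b - t * (b - a)) / (b - a)) / 2"

lemma DERIV_trapezoid_primitive: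
  fixes a b t :: real
  assumes "0 < b - t * (b - a)" "a \<noteq> b"
  shows "(trapezoid_primitive a b
      has_real_derivative (b - a)\<^sup>2 * (t * (1 - t) / (b - t * (b - a)) ^ 3)) (at t)"
proof -
  define d where "d = b - a"
  define x where "x = b - t * d"
  have pos: "x > 0" "d \<noteq> 0" using assms by (auto simp: d_def x_def)
  have dx: "((\<lambda>t. b - t * d) has_real_derivative - d) (at t)"
    by (auto intro!: derivative_eq_intros)
  have "((\<lambda>t. (t * (1 - t) * d / (b - t * d)\<^sup>2 - (1 - 2 * t) / (b - t * d)
        + 2 * ln (b - t * d) / d) / 2)
      has_real_derivative
        (((1 - 2 * t) * d * x\<^sup>2 - t * (1 - t) * d * (2 * x * (- d))) / (x\<^sup>2 * x\<^sup>2)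
        - ((- 2) * x - (1 - 2 * t) * (- d)) / (x * x)
        + 2 * ((- d) / x) / d) / 2) (at t)"
    unfolding x_def
  proof (intro DERIV_cdivide DERIV_add DERIV_diff DERIV_divide DERIV_cmult dx)
    show "((\<lambda>t. t * (1 - t) * d) has_real_derivative (1 - 2 * t) * d) (at t)"
      by (auto intro!: derivative_eq_intros simp: algebra_simps)
    show "((\<lambda>t. (b - t * d)\<^sup>2) has_real_derivative 2 * (b - t * d) * (- d)) (at t)"
      by (auto intro!: derivative_eq_intros)
    show "((\<lambda>t. 1 - 2 * t) has_real_derivative - 2) (at t)"
      by (auto intro!: derivative_eq_intros)
    show "((\<lambda>t. ln (b - t * d)) has_real_derivative - d / (b - t * d)) (at t)"
      using pos dx by (auto intro!: derivative_eq_intros simp: x_def)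
  qed (use pos in \<open>auto simp: x_def power2_eq_square\<close>)
  also have "(((1 - 2 * t) * d * x\<^sup>2 - t * (1 - t) * d * (2 * x * (- d))) / (x\<^sup>2 * x\<^sup>2)
        - ((- 2) * x - (1 - 2 * t) * (- d)) / (x * x)
        + 2 * ((- d) / x) / d) / 2 = d\<^sup>2 * (t * (1 - t) / x ^ 3)"
    using pos by (simp add: divide_simps) algebra
  finally show ?thesis
    by (simp add: d_def x_def trapezoid_primitive_def [abs_def])
qed

lemma segment_point_pos:
  fixes a b t :: real
  assumes "0 < a" "a < b" "t \<le> 1"
  shows "0 < b - t * (b - a)"
proof -
  have "t * (b - a) \<le> 1 * (b - a)"
    using assms by (intro mult_right_mono) auto
  also have "\<dots> < b" using assms by simp
  finally show ?thesis by simp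
qed

lemma trapezoid_primitive_increment:
  fixes a b :: real
  shows "trapezoid_primitive a b 1 - trapezoid_primitive a b 0
    = 1 / harmonic_mean a b - 1 / logarithmic_mean a b"
proof -
  have "1 / logarithmic_mean a b = (ln a - ln b) / (a - b)"
    by (simp add: logarithmic_mean_def)
  also have "\<dots> = (ln b - ln a) / (b - a)"
    by (metis minus_diff_eq minus_divide_divide)
  finally have "1 / logarithmic_mean a b = (ln b - ln a) / (b - a)" .
  moreover have "trapezoid_primitive a b 1 - trapezoid_primitive a b 0
      = (1 / a + 1 / b) / 2 - (ln b - ln a) / (b - a)"
  proof -
    have split: "(r + 2 * u / d) / 2 - (2 * v / d - s) / 2 = (r + s) / 2 - (v - u) / d"
      for r s u v d :: real
      by (simp add: add_divide_distrib diff_divide_distrib)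
    have "trapezoid_primitive a b 1 - trapezoid_primitive a b 0
        = (1 / a + 2 * ln a / (b - a)) / 2 - (2 * ln b / (b - a) - 1 / b) / 2"
      by (simp add: trapezoid_primitive_def)
    also have "\<dots> = (1 / a + 1 / b) / 2 - (ln b - ln a) / (b - a)"
      by (rule split)
    finally show ?thesis .
  qed
  ultimately show ?thesis
    by (simp add: harmonic_mean_def)
qed

lemma trapezoid_error_nonneg:
  fixes a b :: real
  assumes "0 < a" "a < b"
  shows "0 \<le> 1 / harmonic_mean a b - 1 / logarithmic_mean a b"
proof -
  define E where "E = trapezoid_primitive a b"
  have "E 0 \<le> E 1"
  proof (rule DERIV_nonneg_imp_nondecreasing [where f = E])
    fix t :: real assume t: "0 \<le> t" "t \<le> 1"
    have x: "0 < b - t * (b - a)"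
      using segment_point_pos assms t by blast
    have "DERIV E t :> (b - a)\<^sup>2 * (t * (1 - t) / (b - t * (b - a)) ^ 3)"
      unfolding E_def using x assms by (intro DERIV_trapezoid_primitive) auto
    moreover have "0 \<le> (b - a)\<^sup>2 * (t * (1 - t) / (b - t * (b - a)) ^ 3)"
      using t x assms by (intro mult_nonneg_nonneg divide_nonneg_nonneg zero_le_power) auto
    ultimately show "\<exists>y. DERIV E t :> y \<and> 0 \<le> y" by blast
  qed simp
  then show ?thesis
    using trapezoid_primitive_increment [of a b] by (simp add: E_def)
qed

section \<open>The Beta integrals\<close>

text \<open>
  For positive \<open>t\<close> the derivative is
  \<open>(1 - t) * t powr p * (t * A + (1 - t) * B)\<close>, so the increment over \<open>[0, 1]\<close> evaluates the two
  Beta integrals of the Hoelder bound.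
\<close>

definition beta_primitive :: "real \<Rightarrow> real \<Rightarrow> real \<Rightarrow> real \<Rightarrow> real" where
  "beta_primitive p A B t =
     A * (t powr (p + 2) / (p + 2) - t powr (p + 3) / (p + 3))
   + B * (t powr (p + 1) / (p + 1) - 2 * (t powr (p + 2) / (p + 2)) + t powr (p + 3) / (p + 3))"

lemma DERIV_beta_primitive:
  fixes p A B t :: real
  assumes "- 1 < p" "0 < t"
  shows "(beta_primitive p A B has_real_derivative
      (1 - t) * (t powr p * (t * A + (1 - t) * B))) (at t)"
proof -
  have D: "((\<lambda>t. t powr (p + k) / (p + k)) has_real_derivative t powr (p + k - 1)) (at t)"
    if "k \<ge> 1" for k
  proof -
    have "p + k \<noteq> 0" using that assms by simp
    then show ?thesis
      using DERIV_cdivide [OF has_real_derivative_powr [of t "p + k"], of "p + k"] assms by simp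
  qed
  have "(beta_primitive p A B has_real_derivative
      A * (t powr (p + 2 - 1) - t powr (p + 3 - 1))
      + B * (t powr (p + 1 - 1) - 2 * t powr (p + 2 - 1) + t powr (p + 3 - 1))) (at t)"
    unfolding beta_primitive_def [abs_def] by (intro DERIV_add DERIV_diff DERIV_cmult D) auto
  moreover have "t powr (p + 2 - 1) = t powr p * t" "t powr (p + 3 - 1) = t powr p * t\<^sup>2"
    using assms powr_add [of t p 1] powr_add [of t p 2]
    by (simp_all add: powr_numeral add.commute)
  ultimately show ?thesis
    by (simp add: algebra_simps power2_eq_square)
qed

lemma continuous_on_beta_primitive:
  assumes "- 1 < p"
  shows "continuous_on {0..1} (beta_primitive p A B)"
  unfolding beta_primitive_def [abs_def]
  using assms by (auto intro!: continuous_intros continuous_on_powr')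

lemma beta_primitive_increment:
  assumes "- 1 < p"
  shows "beta_primitive p A B 1 - beta_primitive p A B 0
    = (A + 2 * B / (p + 1)) / ((p + 2) * (p + 3))"
proof -
  have "p + 1 \<noteq> 0" "p + 2 \<noteq> 0" "p + 3 \<noteq> 0" using assms by auto
  then show ?thesis
    by (simp add: beta_primitive_def divide_simps) algebra
qed

section \<open>The estimate\<close>

text \<open>
  The integrated form of Young's inequality with scale \<open>c\<close>, applied to \<open>t / x(t)^3\<close> under the
  weight \<open>1 - t\<close>. The constant \<open>1 / 2\<close> in the last term is the mass of that weight.
\<close>

lemma trapezoid_error_le_scaled:
  fixes a b c p :: real
  assumes a: "0 < a" and ab: "a < b" and p: "1 \<le> p" and c: "0 < c"
  shows "1 / harmonic_mean a b - 1 / logarithmic_mean a b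
    \<le> (b - a)\<^sup>2 * (c powr (1 - p) / p
          * ((a powr (- (3 * p)) + 2 * b powr (- (3 * p)) / (p + 1)) / ((p + 2) * (p + 3)))
        + (1 - 1 / p) * c / 2)"
proof -
  have p': "- 1 < p" using p by simp
  define A where "A = a powr (- (3 * p))"
  define B where "B = b powr (- (3 * p))"
  define E where "E = trapezoid_primitive a b"
  \<comment> \<open>An antiderivative of the majorant that Young's inequality and convexity give for the
    derivative of \<open>E\<close>; its last part integrates the weight \<open>1 - t\<close>.\<close>
  define U where "U = (\<lambda>t. (b - a)\<^sup>2 * (c powr (1 - p) / p * beta_primitive p A B t
      + (1 - 1 / p) * c * (t - t\<^sup>2 / 2)))"
  have x_pos: "0 < b - t * (b - a)" if "t \<le> 1" for t
    using segment_point_pos a ab that by blast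
  have "U 0 - E 0 \<le> U 1 - E 1"
  proof (rule DERIV_nonneg_imp_increasing_open [where f = "\<lambda>t. U t - E t"])
    fix t :: real assume t: "0 < t" "t < 1"
    define x where "x = b - t * (b - a)"
    have x: "0 < x" using x_pos [of t] t by (simp add: x_def)
    have dU: "(U has_real_derivative (b - a)\<^sup>2 *
        (c powr (1 - p) / p * ((1 - t) * (t powr p * (t * A + (1 - t) * B)))
          + (1 - 1 / p) * c * (1 - t))) (at t)"
    proof -
      have "((\<lambda>t. t - t\<^sup>2 / 2) has_real_derivative 1 - t) (at t)"
        by (auto intro!: derivative_eq_intros)
      then show ?thesis
        unfolding U_def by (intro DERIV_cmult DERIV_add DERIV_beta_primitive p' t)
    qed
    have dE: "(E has_real_derivative (b - a)\<^sup>2 * (t * (1 - t) / x ^ 3)) (at t)"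
      unfolding E_def x_def
      by (rule DERIV_trapezoid_primitive) (use x ab in \<open>auto simp: x_def\<close>)
    have conv: "x powr (- (3 * p)) \<le> t * A + (1 - t) * B"
    proof -
      have "x = (1 - t) * b + t * a" by (simp add: x_def algebra_simps)
      then show ?thesis
        using convex_onD [OF powr_minus_convex [of "3 * p"], of t b a] a ab p t
        by (simp add: A_def B_def)
    qed
    have "t / x ^ 3 \<le> c powr (1 - p) * (t / x ^ 3) powr p / p + (1 - 1 / p) * c"
      using t x c p by (intro le_scaled_powr) auto
    also have "(t / x ^ 3) powr p = t powr p * x powr (- (3 * p))"
      using t x by (simp add: powr_divide powr_minus_divide powr_powr
          flip: powr_numeral)
    also have "c powr (1 - p) * (t powr p * x powr (- (3 * p))) / p + (1 - 1 / p) * c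
        \<le> c powr (1 - p) * (t powr p * (t * A + (1 - t) * B)) / p + (1 - 1 / p) * c"
      using conv p by (intro add_right_mono divide_right_mono mult_left_mono) auto
    finally have "(1 - t) * (t / x ^ 3)
        \<le> (1 - t) * (c powr (1 - p) * (t powr p * (t * A + (1 - t) * B)) / p + (1 - 1 / p) * c)"
      using t by (intro mult_left_mono) auto
    moreover have "(1 - t) * (k * y / p + m) = k / p * ((1 - t) * y) + m * (1 - t)"
      for k y m :: real
      by (simp add: algebra_simps add_divide_distrib diff_divide_distrib)
    ultimately have "t * (1 - t) / x ^ 3
        \<le> c powr (1 - p) / p * ((1 - t) * (t powr p * (t * A + (1 - t) * B)))
          + (1 - 1 / p) * c * (1 - t)"
      by (simp add: mult.commute)
    then have "0 \<le> (b - a)\<^sup>2 *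
        (c powr (1 - p) / p * ((1 - t) * (t powr p * (t * A + (1 - t) * B)))
          + (1 - 1 / p) * c * (1 - t)) - (b - a)\<^sup>2 * (t * (1 - t) / x ^ 3)"
      by (subst diff_ge_0_iff_ge, intro mult_left_mono) auto
    then show "\<exists>y. DERIV (\<lambda>t. U t - E t) t :> y \<and> 0 \<le> y"
      using DERIV_diff [OF dU dE] by blast
  next
    have "continuous_on {0..1} E"
      unfolding E_def trapezoid_primitive_def [abs_def] using x_pos ab
      by (intro continuous_intros) (auto simp: less_imp_neq [symmetric] dest: x_pos)
    moreover have "continuous_on {0..1} U"
      unfolding U_def by (intro continuous_intros continuous_on_beta_primitive p') auto
    ultimately show "continuous_on {0..1} (\<lambda>t. U t - E t)"
      by (intro continuous_on_diff)
  qed simp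
  then have "E 1 - E 0 \<le> U 1 - U 0" by simp
  also have "U 1 - U 0 = (b - a)\<^sup>2 * (c powr (1 - p) / p
      * (beta_primitive p A B 1 - beta_primitive p A B 0) + (1 - 1 / p) * c / 2)"
    by (simp add: U_def algebra_simps)
  finally show ?thesis
    using trapezoid_primitive_increment [of a b]
    by (simp add: beta_primitive_increment [OF p'] E_def A_def B_def)
qed

theorem theorem4p5:
  fixes a b p :: real
  assumes "0 < a" and "a < b" and "1 \<le> p"
  shows "\<bar>1 / harmonic_mean a b - 1 / logarithmic_mean a b\<bar>
    \<le> (b - a)\<^sup>2 / (2 powr (1 - 1 / p) * ((p + 2) * (p + 3)) powr (1 / p))
      * (1 / a powr (3 * p) + 2 / ((p + 1) * b powr (3 * p))) powr (1 / p)"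
proof -
  define N where "N = 1 / a powr (3 * p) + 2 / ((p + 1) * b powr (3 * p))"
  define D where "D = (p + 2) * (p + 3)"
  \<comment> \<open>A minimiser over \<open>c\<close> of the bound in \<open>trapezoid_error_le_scaled\<close>; at this value both
    of its terms are multiples of \<open>c / 2\<close>, with weights \<open>1 / p\<close> and \<open>1 - 1 / p\<close>.\<close>
  define c where "c = (2 * (N / D)) powr (1 / p)"
  have N: "N > 0" using assms by (simp add: N_def add_pos_pos)
  have D: "D > 0" using assms by (simp add: D_def)
  have c: "c > 0" using N D by (simp add: c_def)
  have "c powr p = 2 * (N / D)"
    using N D assms by (simp add: c_def powr_powr)
  then have cp: "c powr (1 - p) * (N / D) = c / 2"
    using c N D by (simp add: powr_diff)
  have "1 / harmonic_mean a b - 1 / logarithmic_mean a b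
      \<le> (b - a)\<^sup>2 * (c powr (1 - p) / p * (N / D) + (1 - 1 / p) * c / 2)"
    using trapezoid_error_le_scaled [OF assms c]
    by (simp add: N_def D_def powr_minus_divide mult.commute)
  also have "c powr (1 - p) / p * (N / D) = c / 2 / p"
    by (simp flip: cp)
  also have "c / 2 / p + (1 - 1 / p) * c / 2 = c / 2"
    by (simp add: field_simps)
  also have "c / 2 = N powr (1 / p) / (2 powr (1 - 1 / p) * D powr (1 / p))"
    using N D by (simp add: c_def powr_mult powr_divide powr_diff mult.commute)
  finally show ?thesis
    using trapezoid_error_nonneg [OF assms(1,2)]
    by (simp add: N_def D_def)
qed

end
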